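(* Let $X,Y$ be Banach spaces and $A\colon X\to Y$ a bounded linear operator such that $\ker(A)$ is complemented, and let $\mathcal{P}_{\ker(A)}\colon X\to X$ be a bounded linear projection with $\operatorname{ran}(\mathcal{P}_{\ker(A)})=\ker(A)$. Let $(\mathcal{U}_\theta)_{\theta\in\Theta}$ be a family of Lipschitz continuous functions $\mathcal{U}_\theta\colon X\to X$ and let $(f_\theta)_{\theta\in\Theta}$ be the associated null-space network, $f_\theta=\mathrm{Id}_X+\mathcal{P}_{\ker(A)}\circ\mathcal{U}_\theta$. Let $B\colon\operatorname{ran}(A)\to X$ be a linear right inverse of $A$, let $\mathcal{D}_0\subseteq B(\operatorname{ran}(A))$, and let $(\mathcal{B}_\delta)_{\delta>0}$, $\mathcal{B}_\delta\colon Y\to X$, be a regularization method for $A$ on the signal class $\mathcal{D}_0$. Then for every $\theta\in\Theta$ the family $(f_\theta\circ\mathcal{B}_\delta)_{\delta>0}$ is a regularization method for $A$ on the signal class $f_\theta(\mathcal{D}_0)$.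
   Context: A right inverse of $A$ on $\operatorname{ran}(A)$ is a map $B\colon\operatorname{ran}(A)\to X$ with $A(B(y))=y$ for all $y\in\operatorname{ran}(A)$. For a set $\mathcal{D}\subseteq X$ (the signal class), a family $(\mathcal{B}_\delta)_{\delta>0}$ of maps $\mathcal{B}_\delta\colon Y\to X$ (no continuity required) is called a (convergent) regularization method for $A$ on $\mathcal{D}$ if for every $x\in\mathcal{D}$ $$\lim_{\delta\to0}\ \sup\bigl\{\|x-\mathcal{B}_\delta(y^\delta)\| \;\big|\; y^\delta\in Y,\ \|Ax-y^\delta\|\le\delta\bigr\}=0 .$$ *)

theory Defs
  imports "HOL-Analysis.Analysis"
begin

definition kernel :: "('a::real_vector \<Rightarrow> 'b::real_vector) \<Rightarrow> 'a set" where
  "kernel A = {x. A x = 0}"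

definition complemented :: "'a::real_normed_vector set \<Rightarrow> bool" where
  "complemented S \<longleftrightarrow> subspace S \<and> closed S \<and>
     (\<exists>T. subspace T \<and> closed T \<and> S \<inter> T = {0} \<and> {s + t |s t. s \<in> S \<and> t \<in> T} = UNIV)"

definition bounded_linear_projection :: "('a::real_normed_vector \<Rightarrow> 'a) \<Rightarrow> bool" where
  "bounded_linear_projection P \<longleftrightarrow> bounded_linear P \<and> P \<circ> P = P"

definition lipschitz_continuous :: "('a::metric_space \<Rightarrow> 'b::metric_space) \<Rightarrow> bool" where
  "lipschitz_continuous f \<longleftrightarrow> (\<exists>L. L-lipschitz_on UNIV f)"

definition null_space_network ::
  "('a::real_normed_vector \<Rightarrow> 'a) \<Rightarrow> ('t \<Rightarrow> 'a \<Rightarrow> 'a) \<Rightarrow> 't \<Rightarrow> 'a \<Rightarrow> 'a" where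
  "null_space_network P U \<theta> = (\<lambda>x. x + (P \<circ> U \<theta>) x)"

(* A map defined on a subspace S is represented by a total function whose values
   outside S are arbitrary, so linearity is only asserted on S. *)
definition linear_on :: "'a::real_vector set \<Rightarrow> ('a \<Rightarrow> 'b::real_vector) \<Rightarrow> bool" where
  "linear_on S f \<longleftrightarrow>
     (\<forall>x\<in>S. \<forall>y\<in>S. f (x + y) = f x + f y) \<and> (\<forall>c. \<forall>x\<in>S. f (c *\<^sub>R x) = c *\<^sub>R f x)"

definition right_inverse_on_range :: "('a \<Rightarrow> 'b) \<Rightarrow> ('b \<Rightarrow> 'a) \<Rightarrow> bool" where
  "right_inverse_on_range A B \<longleftrightarrow> (\<forall>y\<in>range A. A (B y) = y)"

(* The supremum is taken in [0,\<infinity>], since it may be infinite for some \<delta>.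
   Only the members R \<delta> with \<delta> > 0 matter: the limit is one-sided. *)
definition regularization_method ::
  "('a::real_normed_vector \<Rightarrow> 'b::real_normed_vector) \<Rightarrow> 'a set \<Rightarrow> (real \<Rightarrow> 'b \<Rightarrow> 'a) \<Rightarrow> bool" where
  "regularization_method A D R \<longleftrightarrow>
     (\<forall>x\<in>D. ((\<lambda>\<delta>. SUP y\<in>{y. norm (A x - y) \<le> \<delta>}. ennreal (norm (x - R \<delta> y))) \<longlongrightarrow> 0)
              (at_right 0))"

end

theory Submission
  imports Defs
begin

text \<open>
  A null-space network \<open>f\<close> is Lipschitz and satisfies \<open>A (f x) = A x\<close>. Hence \<open>f x\<close> and \<open>x\<close> admit the
  same noisy data, and the worst-case error at \<open>f x\<close> is at most the Lipschitz constant of \<open>f\<close> times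
  the worst-case error at \<open>x\<close>.
\<close>

lemma bounded_linear_lipschitz_continuous:
  assumes "bounded_linear P"
  shows "lipschitz_continuous P"
  using bounded_linear.lipschitz_boundE[OF assms] unfolding lipschitz_continuous_def by metis

lemma lipschitz_continuous_compose:
  assumes "lipschitz_continuous g" and "lipschitz_continuous f"
  shows "lipschitz_continuous (g \<circ> f)"
proof -
  obtain C D where "C-lipschitz_on UNIV g" and "D-lipschitz_on UNIV f"
    using assms unfolding lipschitz_continuous_def by blast
  \<comment> \<open>The composition rule wants the bound for \<open>g\<close> on the range of
    \<open>f\<close>, so the global bound is restricted.\<close>
  then have "(C * D)-lipschitz_on UNIV (g \<circ> f)"
    by (metis lipschitz_on_compose lipschitz_on_subset subset_UNIV)
  then show ?thesis
    unfolding lipschitz_continuous_def by blast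
qed

lemma null_space_network_lipschitz_continuous:
  assumes "bounded_linear P" and "lipschitz_continuous (U \<theta>)"
  shows "lipschitz_continuous (null_space_network P U \<theta>)"
proof -
  obtain C where "C-lipschitz_on UNIV (P \<circ> U \<theta>)"
    using lipschitz_continuous_compose[OF bounded_linear_lipschitz_continuous] assms
    unfolding lipschitz_continuous_def by metis
  \<comment> \<open>The summand 1 is the Lipschitz constant of the identity.\<close>
  then have "(1 + C)-lipschitz_on UNIV (null_space_network P U \<theta>)"
    unfolding null_space_network_def by (intro lipschitz_on_add lipschitz_on_id)
  then show ?thesis
    unfolding lipschitz_continuous_def by blast
qed

text \<open>The correction \<open>P (U \<theta> x)\<close> lies in the kernel of \<open>A\<close>,
  so \<open>A\<close> annihilates it.\<close>

lemma null_space_network_preserves_data: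
  assumes "linear A" and "range P \<subseteq> kernel A"
  shows "A (null_space_network P U \<theta> x) = A x"
  using assms by (auto simp: null_space_network_def kernel_def linear_add)

text \<open>Isolates the two properties of a network that matter. Data are compared only at signals
  in \<open>D\<close>, whereas the Lipschitz bound is global because a reconstruction
  \<open>R \<delta> y\<close> may lie anywhere.\<close>

lemma regularization_method_lipschitz_image:
  assumes R: "regularization_method A D R"
    and "lipschitz_continuous f" and data: "\<And>x. x \<in> D \<Longrightarrow> A (f x) = A x"
  shows "regularization_method A (f ` D) (\<lambda>\<delta>. f \<circ> R \<delta>)"
  unfolding regularization_method_def
proof (rule ballI, erule imageE, hypsubst)
  fix x assume x: "x \<in> D"
  obtain L where L: "L-lipschitz_on UNIV f"
    using assms(2) unfolding lipschitz_continuous_def by blast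
  define E where "E \<delta> = (SUP y\<in>{y. norm (A x - y) \<le> \<delta>}. ennreal (norm (x - R \<delta> y)))" for \<delta>
  \<comment> \<open>Multiplication by \<open>ennreal L\<close> is continuous because this factor is
    finite; \<open>E \<delta>\<close> itself may be infinite for some \<delta>.\<close>
  have lim: "((\<lambda>\<delta>. ennreal L * E \<delta>) \<longlongrightarrow> ennreal L * 0) (at_right 0)"
    using R x by (intro ennreal_tendsto_cmult) (auto simp: regularization_method_def E_def)
  have le: "(SUP y\<in>{y. norm (A (f x) - y) \<le> \<delta>}. ennreal (norm (f x - (f \<circ> R \<delta>) y)))
      \<le> ennreal L * E \<delta>" for \<delta>
  proof (rule SUP_least)
    fix y assume "y \<in> {y. norm (A (f x) - y) \<le> \<delta>}"
    \<comment> \<open>Since \<open>A (f x) = A x\<close>, the datum \<open>y\<close> is also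
      admissible for \<open>x\<close>.\<close>
    then have le_E: "ennreal (norm (x - R \<delta> y)) \<le> E \<delta>"
      unfolding E_def by (intro SUP_upper) (simp add: data x)
    have "ennreal (norm (f x - (f \<circ> R \<delta>) y)) \<le> ennreal L * ennreal (norm (x - R \<delta> y))"
      using lipschitz_onD[OF L, of x "R \<delta> y"] lipschitz_on_nonneg[OF L]
      by (simp add: dist_norm ennreal_leI flip: ennreal_mult')
    also have "\<dots> \<le> ennreal L * E \<delta>"
      by (rule mult_left_mono[OF le_E zero_le])
    finally show "ennreal (norm (f x - (f \<circ> R \<delta>) y)) \<le> ennreal L * E \<delta>" .
  qed
  show "((\<lambda>\<delta>. SUP y\<in>{y. norm (A (f x) - y) \<le> \<delta>}. ennreal (norm (f x - (f \<circ> R \<delta>) y)))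
      \<longlongrightarrow> 0) (at_right 0)"
    \<comment> \<open>Squeeze between the constant 0 and \<open>ennreal L * E \<delta>\<close>; the
      lower bound is automatic in \<open>ennreal\<close>, and \<open>le\<close> holds for every
      \<delta>.\<close>
    by (rule tendsto_sandwich[OF _ always_eventually tendsto_const lim[simplified]])
      (simp, intro allI le)
qed

theorem theorem17:
  fixes A :: "'a::banach \<Rightarrow> 'b::banach"
    and P :: "'a \<Rightarrow> 'a"
    and \<Theta> :: "'t set"
    and U :: "'t \<Rightarrow> 'a \<Rightarrow> 'a"
    and B :: "'b \<Rightarrow> 'a"
    and D\<^sub>0 :: "'a set"
    and R :: "real \<Rightarrow> 'b \<Rightarrow> 'a"
  assumes "bounded_linear A"
    and "complemented (kernel A)"
    and "bounded_linear_projection P" and "range P = kernel A"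
    and "\<And>\<theta>. \<theta> \<in> \<Theta> \<Longrightarrow> lipschitz_continuous (U \<theta>)"
    and "linear_on (range A) B" and "right_inverse_on_range A B"
    and "D\<^sub>0 \<subseteq> B ` range A"
    and "regularization_method A D\<^sub>0 R"
  shows "\<forall>\<theta>\<in>\<Theta>. regularization_method A (null_space_network P U \<theta> ` D\<^sub>0)
                 (\<lambda>\<delta>. null_space_network P U \<theta> \<circ> R \<delta>)"
proof
  fix \<theta> assume "\<theta> \<in> \<Theta>"
  have "bounded_linear P"
    using assms(3) by (simp add: bounded_linear_projection_def)
  with assms(5)[OF \<open>\<theta> \<in> \<Theta>\<close>] have "lipschitz_continuous (null_space_network P U \<theta>)"
    by (intro null_space_network_lipschitz_continuous)
  moreover have "A (null_space_network P U \<theta> x) = A x" for x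
    using assms(1,4) by (intro null_space_network_preserves_data) (auto intro: bounded_linear.linear)
  ultimately show "regularization_method A (null_space_network P U \<theta> ` D\<^sub>0)
      (\<lambda>\<delta>. null_space_network P U \<theta> \<circ> R \<delta>)"
    using assms(9) by (intro regularization_method_lipschitz_image)
qed

end
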